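(* Let $n\ge 2$, let $(q,m)$ be a planar balanced collisionless central configuration with constant $\lambda$, and let the $n$ primaries perform the associated rigid motion $x_j(t)=Q(\sqrt{\lambda}\,t)q_j$, $j=1,\dots,n$. Then the complete $(n+1)$-body system, consisting of the $n$ primaries together with a massless particle moving on the $z$-axis with position $x_0(t)=(0,0,z(t))$, where $$\ddot z=-\sum_{i=1}^n\frac{m_iz}{(|q_i|^2+z^2)^{3/2}},$$ has infinitely many periodic solutions $t\mapsto(x_0(t),x_1(t),\dots,x_n(t))$.
   Context: Masses are positive, positions $q_i$ are pairwise distinct points of the plane $\Pi=\{z=0\}\subset\mathbb{R}^3$, center of mass at the origin, gravitational constant $1$. $Q(\theta)$ is the rotation by angle $\theta$ about the $z$-axis. Central configuration with constant $\lambda$: $\nabla_jU(q)+\lambda m_jq_j=0$ for all $j$, where $U(q)=\sum_{i<j}\frac{m_im_j}{|q_i-q_j|}$. Balanced: for every $r>0$ such that $F_r:=\{i:|q_i|=r\}\ne\emptyset$, $\sum_{i\in F_r}m_iq_i=0$. Collisionless: $q_i\ne0$ for all $i$. *)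

theory Defs
  imports "HOL-Analysis.Analysis"
begin

(* The n primaries are indexed by a finite linearly ordered type 'n, with n = CARD('n). *)

definition newton_potential ::
  "('n::{finite,linorder} \<Rightarrow> real) \<Rightarrow> ('n \<Rightarrow> real ^ 3) \<Rightarrow> real" where
  "newton_potential m q = (\<Sum>j\<in>UNIV. \<Sum>i\<in>{i. i < j}. m i * m j / norm (q i - q j))"

definition planar_configuration ::
  "('n::finite \<Rightarrow> real) \<Rightarrow> ('n \<Rightarrow> real ^ 3) \<Rightarrow> bool" where
  "planar_configuration m q \<longleftrightarrow>
     (\<forall>i. m i > 0) \<and> inj q \<and> (\<forall>i. q i $ 3 = 0) \<and> (\<Sum>i\<in>UNIV. m i *\<^sub>R q i) = 0"

(* The vector g is the partial gradient of the potential in the j-th position. *)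
definition central_configuration ::
  "real \<Rightarrow> ('n::{finite,linorder} \<Rightarrow> real) \<Rightarrow> ('n \<Rightarrow> real ^ 3) \<Rightarrow> bool" where
  "central_configuration l m q \<longleftrightarrow>
     (\<forall>j. \<exists>g. GDERIV (\<lambda>y. newton_potential m (q(j := y))) (q j) :> g \<and>
               g + (l * m j) *\<^sub>R q j = 0)"

definition balanced_configuration ::
  "('n::finite \<Rightarrow> real) \<Rightarrow> ('n \<Rightarrow> real ^ 3) \<Rightarrow> bool" where
  "balanced_configuration m q \<longleftrightarrow>
     (\<forall>r>0. {i. norm (q i) = r} \<noteq> {} \<longrightarrow> (\<Sum>i | norm (q i) = r. m i *\<^sub>R q i) = 0)"

definition collisionless :: "('n \<Rightarrow> real ^ 3) \<Rightarrow> bool" where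
  "collisionless q \<longleftrightarrow> (\<forall>i. q i \<noteq> 0)"

definition rotation_z :: "real \<Rightarrow> real ^ 3 ^ 3" where
  "rotation_z \<theta> = vector [vector [cos \<theta>, - sin \<theta>, 0],
                          vector [sin \<theta>,   cos \<theta>, 0],
                          vector [0, 0, 1]]"

definition vertical_motion ::
  "('n::finite \<Rightarrow> real) \<Rightarrow> ('n \<Rightarrow> real ^ 3) \<Rightarrow> (real \<Rightarrow> real) \<Rightarrow> bool" where
  "vertical_motion m q z \<longleftrightarrow>
     (\<exists>v. \<forall>t. (z has_real_derivative v t) (at t) \<and>
        (v has_real_derivative
           - (\<Sum>i\<in>UNIV. m i * z t / ((norm (q i))\<^sup>2 + (z t)\<^sup>2) powr (3/2))) (at t))"

(* A motion of the complete system is t |-> (x_0(t), (x_j(t))_j), with x_0 the massless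
   particle. *)
definition complete_system_solution ::
  "real \<Rightarrow> ('n::finite \<Rightarrow> real) \<Rightarrow> ('n \<Rightarrow> real ^ 3) \<Rightarrow>
     (real \<Rightarrow> (real ^ 3) \<times> ('n \<Rightarrow> real ^ 3)) \<Rightarrow> bool" where
  "complete_system_solution l m q x \<longleftrightarrow>
     (\<exists>z. vertical_motion m q z \<and>
        (\<forall>t. x t = (vector [0, 0, z t], \<lambda>j. rotation_z (sqrt l * t) *v q j)))"

definition periodic_motion :: "(real \<Rightarrow> 'a) \<Rightarrow> bool" where
  "periodic_motion x \<longleftrightarrow> (\<exists>T>0. \<forall>t. x (t + T) = x t)"

(* The vertical equation is autonomous, so shifting the phase of the massless particle turns
   one non-constant solution into a continuum of solutions.  Solutions that differ in this
   way are not to be counted separately. *)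
definition same_up_to_phase ::
  "(real \<Rightarrow> (real ^ 3) \<times> 'b) \<Rightarrow> (real \<Rightarrow> (real ^ 3) \<times> 'b) \<Rightarrow> bool" where
  "same_up_to_phase x y \<longleftrightarrow> (\<exists>s. \<forall>t. fst (y t) = fst (x (t + s)))"

end

theory Submission
  imports Defs
begin

text \<open>
  Parametrise an oscillation of amplitude a by z = a * sin p. With
  A = sqrt (r^2 + z^2) and B = sqrt (r^2 + a^2), energy conservation takes the regular form
  p'^2 = (sum over the primaries of 2 m / (A B (A + B))), whose right-hand side is positive
  and periodic in p. So p is the inverse of an antiderivative of the reciprocal speed, no
  existence theory for differential equations is needed, and the period of z is the integral
  of the reciprocal speed over [0, 2 pi]. It depends continuously on a and is bounded below by
  a multiple of a, so by the intermediate value theorem every sufficiently large multiple of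
  the rotation period of the primaries is the period of some vertical oscillation.
  Oscillations with different amplitudes do not agree up to a phase.
\<close>

section \<open>Speed of the phase\<close>

text \<open>The energy equation z'^2 / 2 = (sum of m (1/A - 1/B)) with z' = a cos p p' has to be
  divided by (a cos p)^2. Since 1/A - 1/B = (B^2 - A^2) / (A B (A + B)) and B^2 - A^2 = (a cos p)^2,
  the singularity at the turning points cancels.\<close>

definition phase_speed ::
  "('n::finite \<Rightarrow> real) \<Rightarrow> ('n \<Rightarrow> real) \<Rightarrow> real \<Rightarrow> real \<Rightarrow> real" where
  "phase_speed m r a p = sqrt (\<Sum>i\<in>UNIV. 2 * m i /
     (sqrt ((r i)\<^sup>2 + (a * sin p)\<^sup>2) * sqrt ((r i)\<^sup>2 + a\<^sup>2) *
      (sqrt ((r i)\<^sup>2 + (a * sin p)\<^sup>2) + sqrt ((r i)\<^sup>2 + a\<^sup>2))))"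

lemma powr_three_halves: "x powr (3/2) = sqrt x ^ 3" if "x > 0" for x :: real
proof -
  have "sqrt x ^ 3 = (x powr (1/2)) powr 3"
    using that by (simp add: powr_half_sqrt powr_numeral)
  then show ?thesis
    by (simp add: powr_powr)
qed

text \<open>With \<open>s\<close> and \<open>c\<close> the sine and cosine of the phase, this is the
  equation of motion for one primary of unit mass: the fraction multiplied by \<open>c\<close> is
  half the phase derivative of 2 / (A B (A + B)). Factoring B^2 - A^2 cancels one A + B, and (2 A +
  B) (B - A) + 2 A^2 = B (A + B) does the rest.\<close>

lemma phase_force_identity:
  fixes A B c s a :: real
  assumes "A > 0" "B > 0" and "a\<^sup>2 * c\<^sup>2 = B\<^sup>2 - A\<^sup>2"
  shows "a * (c * (- ((2 * A + B) * (a\<^sup>2 * s * c)) / (A ^ 3 * B * (A + B)\<^sup>2))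
           - s * (2 / (A * B * (A + B)))) = - (a * s / A ^ 3)"
proof -
  have factor: "a\<^sup>2 * c\<^sup>2 = (B - A) * (A + B)"
    unfolding assms(3) by (simp add: power2_eq_square algebra_simps)
  have "c * ((2 * A + B) * (a\<^sup>2 * s * c)) = (2 * A + B) * s * (a\<^sup>2 * c\<^sup>2)"
    by (simp add: power2_eq_square)
  also have "\<dots> = (2 * A + B) * s * ((B - A) * (A + B))"
    by (simp only: factor)
  finally have eq: "c * (- ((2 * A + B) * (a\<^sup>2 * s * c)) / (A ^ 3 * B * (A + B)\<^sup>2))
      = - ((2 * A + B) * s * ((B - A) * (A + B))) / (A ^ 3 * B * (A + B)\<^sup>2)"
    by simp
  have "A + B \<noteq> 0" using assms by simp
  then show ?thesis
    unfolding eq using assms(1,2)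
    by (simp add: divide_simps power2_eq_square power3_eq_cube) (simp add: algebra_simps)
qed

text \<open>Because A is at least r, and both B and A + B are at least a, each summand is at most 2
  m / (r a^2). The reciprocal speed is time per unit of phase, so the second bound forces long
  periods at large amplitudes.\<close>

lemma phase_speed_bounds:
  fixes m r :: "'n::finite \<Rightarrow> real"
  assumes "\<And>i. m i > 0" "\<And>i. r i > 0" "a > 0"
  shows "phase_speed m r a p > 0"
    and "a / sqrt (\<Sum>i\<in>UNIV. 2 * m i / r i) \<le> 1 / phase_speed m r a p"
proof -
  let ?A = "\<lambda>i. sqrt ((r i)\<^sup>2 + (a * sin p)\<^sup>2)"
  let ?B = "\<lambda>i. sqrt ((r i)\<^sup>2 + a\<^sup>2)"
  have A: "?A i \<ge> r i" and B: "?B i \<ge> a" for i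
    using assms(2)[of i] assms(3) by (simp_all add: real_le_rsqrt)
  have A0: "?A i > 0" and B0: "?B i > 0" for i
    using A[of i] B[of i] assms(2)[of i] assms(3) by linarith+
  have pos: "0 < (\<Sum>i\<in>UNIV. 2 * m i / (?A i * ?B i * (?A i + ?B i)))"
    using assms(1) A0 B0 by (intro sum_pos) (simp_all add: add_pos_pos)
  then show sp: "phase_speed m r a p > 0"
    by (simp add: phase_speed_def)
  have pos': "0 < (\<Sum>i\<in>UNIV. 2 * m i / r i)"
    using assms(1,2) by (intro sum_pos) simp_all
  have "2 * m i / (?A i * ?B i * (?A i + ?B i)) \<le> (2 * m i / r i) / a\<^sup>2" for i
  proof -
    have "a \<le> ?A i + ?B i"
      using A0[of i] B[of i] by linarith
    then have "r i * a * a \<le> ?A i * ?B i * (?A i + ?B i)"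
      using A[of i] B[of i] A0[of i] B0[of i] assms(2)[of i] assms(3)
      by (intro mult_mono mult_nonneg_nonneg) linarith+
    then have "2 * m i / (?A i * ?B i * (?A i + ?B i)) \<le> 2 * m i / (r i * a * a)"
      using assms(1)[of i] assms(2)[of i] assms(3)
      by (intro divide_left_mono mult_pos_pos add_pos_pos A0 B0) linarith+
    then show ?thesis by (simp add: power2_eq_square mult.assoc)
  qed
  then have "(\<Sum>i\<in>UNIV. 2 * m i / (?A i * ?B i * (?A i + ?B i)))
      \<le> (\<Sum>i\<in>UNIV. 2 * m i / r i) / a\<^sup>2"
    unfolding sum_divide_distrib by (intro sum_mono)
  then have "phase_speed m r a p \<le> sqrt (\<Sum>i\<in>UNIV. 2 * m i / r i) / a"
    unfolding phase_speed_def using assms(3)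
    by (auto dest: real_sqrt_le_mono simp only: real_sqrt_divide real_sqrt_abs abs_of_pos)
  then show "a / sqrt (\<Sum>i\<in>UNIV. 2 * m i / r i) \<le> 1 / phase_speed m r a p"
    using sp pos' assms(3) by (simp add: field_simps)
qed

lemma phase_speed_periodic: "phase_speed m r a (p + 2 * pi) = phase_speed m r a p"
  by (simp add: phase_speed_def)

text \<open>Joint continuity in amplitude and phase is what carries over to the period, an integral
  over the phase with the amplitude as parameter.\<close>

lemma continuous_on_phase_speed:
  fixes m r :: "'n::finite \<Rightarrow> real"
  assumes "\<And>i. r i > 0"
  shows "continuous_on S (\<lambda>x. phase_speed m r (fst x) (snd x))"
proof -
  have "sqrt ((r i)\<^sup>2 + y\<^sup>2) > 0" for i y
    using assms[of i] by (simp add: add_pos_nonneg)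
  then have "sqrt ((r i)\<^sup>2 + y\<^sup>2) * sqrt ((r i)\<^sup>2 + w\<^sup>2) *
      (sqrt ((r i)\<^sup>2 + y\<^sup>2) + sqrt ((r i)\<^sup>2 + w\<^sup>2)) > 0" for i y w
    by (intro mult_pos_pos add_pos_pos)
  then have "sqrt ((r i)\<^sup>2 + y\<^sup>2) * sqrt ((r i)\<^sup>2 + w\<^sup>2) *
      (sqrt ((r i)\<^sup>2 + y\<^sup>2) + sqrt ((r i)\<^sup>2 + w\<^sup>2)) \<noteq> 0" for i y w
    by (metis less_irrefl)
  then show ?thesis
    unfolding phase_speed_def by (intro continuous_intros ballI)
qed

text \<open>If p' equals the phase speed, the left-hand side of the second conclusion is the second
  time derivative of a sin p, so that conclusion is Newton's equation in terms of the phase.\<close>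

lemma phase_speed_deriv:
  fixes m r :: "'n::finite \<Rightarrow> real"
  assumes "\<And>i. m i > 0" "\<And>i. r i > 0" "a > 0"
  obtains d where "(phase_speed m r a has_real_derivative d) (at p)"
    and "a * (cos p * d - sin p * phase_speed m r a p) * phase_speed m r a p
       = - (\<Sum>i\<in>UNIV. m i * (a * sin p) / ((r i)\<^sup>2 + (a * sin p)\<^sup>2) powr (3/2))"
proof -
  define A where "A i x = sqrt ((r i)\<^sup>2 + (a * sin x)\<^sup>2)" for i x
  define B where "B i = sqrt ((r i)\<^sup>2 + a\<^sup>2)" for i
  define H where "H x = (\<Sum>i\<in>UNIV. m i * (2 / (A i x * B i * (A i x + B i))))" for x
  define h' where "h' i = - 2 * ((2 * A i p + B i) * (a\<^sup>2 * sin p * cos p))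
      / (A i p ^ 3 * B i * (A i p + B i)\<^sup>2)" for i
  define d where "d = (\<Sum>i\<in>UNIV. m i * h' i) / (2 * phase_speed m r a p)"
  have G: "phase_speed m r a = (\<lambda>x. sqrt (H x))"
    by (simp add: fun_eq_iff phase_speed_def H_def A_def B_def mult.commute)
  have Gpos: "phase_speed m r a p > 0"
    by (rule phase_speed_bounds(1)[OF assms])
  then have Hpos: "H p > 0" by (simp add: G)
  have A0: "A i x > 0" and B0: "B i > 0" for i x
    using assms(2)[of i] by (simp_all add: A_def B_def add_pos_nonneg)
  have dA: "(A i has_real_derivative a\<^sup>2 * sin p * cos p / A i p) (at p)" for i
    using A0[of i p] unfolding A_def
    by (auto intro!: derivative_eq_intros simp: field_simps power2_eq_square)
  have dh: "((\<lambda>x. 2 / (A i x * B i * (A i x + B i))) has_real_derivative h' i) (at p)" for i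
  proof -
    have ne: "A i p \<noteq> 0" "B i \<noteq> 0" "A i p + B i \<noteq> 0"
      using A0[of i p] B0[of i] by auto
    let ?D = "a\<^sup>2 * sin p * cos p / A i p"
    have "((\<lambda>x. A i x * B i * (A i x + B i)) has_real_derivative
        ?D * B i * (2 * A i p + B i)) (at p)"
      using ne by (auto intro!: derivative_eq_intros dA simp: field_simps)
    from DERIV_divide[OF DERIV_const this, of 2]
    have "((\<lambda>x. 2 / (A i x * B i * (A i x + B i))) has_real_derivative
        - (2 * (?D * B i * (2 * A i p + B i))) / (A i p * B i * (A i p + B i))\<^sup>2) (at p)"
      using ne by (simp add: power2_eq_square)
    also have "- (2 * (?D * B i * (2 * A i p + B i))) / (A i p * B i * (A i p + B i))\<^sup>2 = h' i"
      using ne by (simp add: h'_def power_mult_distrib power2_eq_square power3_eq_cube)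
        (simp only: mult_ac)
    finally show ?thesis .
  qed
  have "(H has_real_derivative (\<Sum>i\<in>UNIV. m i * h' i)) (at p)"
    unfolding H_def by (intro DERIV_sum DERIV_cmult dh)
  from DERIV_chain2[where f = sqrt and g = H, OF DERIV_real_sqrt[OF Hpos] this]
  have D: "(phase_speed m r a has_real_derivative d) (at p)"
    unfolding G by (rule DERIV_cong) (simp add: d_def G field_simps)
  \<comment> \<open>The outer factor turns \<open>d\<close> times the speed into half the derivative
    of \<open>H\<close>, the squared speed. This removes the square root and leaves a sum that can
    be treated one primary at a time.\<close>
  have "a * (cos p * d - sin p * phase_speed m r a p) * phase_speed m r a p
      = a * (cos p * (d * phase_speed m r a p) - sin p * (phase_speed m r a p)\<^sup>2)"
    by (simp add: power2_eq_square algebra_simps)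
  also have "\<dots> = a * (cos p * ((\<Sum>i\<in>UNIV. m i * h' i) / 2) - sin p * H p)"
    using Gpos Hpos by (simp add: d_def G)
  also have "\<dots> = (\<Sum>i\<in>UNIV. m i * (a * (cos p * (h' i / 2)
      - sin p * (2 / (A i p * B i * (A i p + B i))))))"
    unfolding H_def sum_divide_distrib sum_distrib_left sum_subtractf[symmetric]
    by (intro sum.cong) (simp_all add: algebra_simps)
  also have "\<dots> = (\<Sum>i\<in>UNIV. m i * - (a * sin p / A i p ^ 3))"
  proof (rule sum.cong[OF refl])
    fix i
    have "a\<^sup>2 * (cos p)\<^sup>2 = (B i)\<^sup>2 - (A i p)\<^sup>2"
      by (simp add: A_def B_def cos_squared_eq power_mult_distrib algebra_simps)
    from phase_force_identity[OF A0 B0 this, of "sin p"]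
    show "m i * (a * (cos p * (h' i / 2) - sin p * (2 / (A i p * B i * (A i p + B i)))))
        = m i * - (a * sin p / A i p ^ 3)"
      by (simp add: h'_def)
  qed
  also have "\<dots> = - (\<Sum>i\<in>UNIV. m i * (a * sin p) / ((r i)\<^sup>2 + (a * sin p)\<^sup>2) powr (3/2))"
  proof -
    have "A i p ^ 3 = ((r i)\<^sup>2 + (a * sin p)\<^sup>2) powr (3/2)" for i
      using assms(2)[of i] by (simp add: A_def powr_three_halves add_pos_nonneg)
    then show ?thesis by (simp add: sum_negf)
  qed
  finally show thesis by (rule that[OF D])
qed

section \<open>Vertical oscillations and their periods\<close>

definition oscillation_period ::
  "('n::finite \<Rightarrow> real) \<Rightarrow> ('n \<Rightarrow> real) \<Rightarrow> real \<Rightarrow> real" where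
  "oscillation_period m r a = integral {0..2 * pi} (\<lambda>p. 1 / phase_speed m r a p)"

text \<open>The last two clauses make the amplitude the maximum of z. A time shift preserves this
  maximum, so it can tell oscillations apart up to phase.\<close>

lemma exists_oscillation:
  fixes m :: "'n::finite \<Rightarrow> real" and q :: "'n \<Rightarrow> real ^ 3"
  assumes "\<And>i. m i > 0" "\<And>i. norm (q i) > 0" "a > 0"
  shows "\<exists>z. vertical_motion m q z
    \<and> (\<forall>t. z (t + oscillation_period m (\<lambda>i. norm (q i)) a) = z t)
    \<and> (\<forall>t. z t \<le> a) \<and> (\<exists>t. z t = a)"
proof -
  define G where "G = phase_speed m (\<lambda>i. norm (q i)) a"
  define T where "T = oscillation_period m (\<lambda>i. norm (q i)) a"
  define c where "c = a / sqrt (\<Sum>i\<in>UNIV. 2 * m i / norm (q i))"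
  note bounds = phase_speed_bounds[of m "\<lambda>i. norm (q i)", OF assms]
  have Gpos: "G p > 0" and Gc: "c \<le> 1 / G p" for p
    using bounds by (simp_all add: G_def c_def)
  have "0 < (\<Sum>i\<in>UNIV. 2 * m i / norm (q i))"
    using assms by (intro sum_pos) simp_all
  then have c0: "c > 0" using assms by (simp add: c_def)
  have contG: "isCont G p" for p
    by (rule phase_speed_deriv[of m "\<lambda>i. norm (q i)" a p, OF assms, folded G_def])
      (rule DERIV_isCont)
  \<comment> \<open>The antiderivative \<tau> is time as a function of the phase, defined on the
    whole real line.\<close>
  have "\<exists>F. \<forall>x. (F has_vector_derivative 1 / G x) (at x)"
    using einterval_antiderivative[of "-\<infinity>" "\<infinity>" "\<lambda>x. 1 / G x"] contG Gpos
    by (force intro!: continuous_intros simp: less_le)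
  then obtain \<tau> where \<tau>: "(\<tau> has_real_derivative 1 / G x) (at x)" for x
    by (auto simp: has_real_derivative_iff_has_vector_derivative)
  \<comment> \<open>This linear growth yields both injectivity and surjectivity of \<tau>.\<close>
  have growth: "\<tau> y - \<tau> x \<ge> c * (y - x)" if "x \<le> y" for x y
  proof -
    have "\<tau> x - c * x \<le> \<tau> y - c * y"
    proof (rule DERIV_nonneg_imp_nondecreasing[OF that])
      fix u
      show "\<exists>d. ((\<lambda>x. \<tau> x - c * x) has_real_derivative d) (at u) \<and> 0 \<le> d"
        using Gc[of u] by (auto intro!: exI derivative_eq_intros \<tau>)
    qed
    then show ?thesis by (simp add: algebra_simps)
  qed
  have inj: "inj \<tau>"
  proof (rule linorder_injI)
    fix x y :: real assume "x < y"
    then have "c * (y - x) > 0" using c0 by simp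
    then show "\<tau> x \<noteq> \<tau> y" using growth[of x y] \<open>x < y\<close> by simp
  qed
  have cont: "isCont \<tau> x" for x using \<tau> DERIV_isCont by blast
  have "\<exists>x. \<tau> x = t" for t
  proof -
    \<comment> \<open>Over a phase interval of length \<open>M\<close>, growth at rate
      \<open>c\<close> covers the distance from \<tau> 0 to \<open>t\<close>.\<close>
    define M where "M = \<bar>t - \<tau> 0\<bar> / c"
    have M: "M \<ge> 0" "c * M = \<bar>t - \<tau> 0\<bar>" using c0 by (simp_all add: M_def)
    have "\<tau> (- M) \<le> t" "t \<le> \<tau> M"
      using growth[of "-M" 0] growth[of 0 M] M by auto
    then show ?thesis
      using IVT[of \<tau> "-M" t M] M cont by auto
  qed
  then have sj: "\<tau> (inv \<tau> t) = t" for t by (metis surjI surj_f_inv_f surj_def)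
  have iv: "inv \<tau> (\<tau> x) = x" for x using inj by simp
  have continv: "isCont (inv \<tau>) t" for t
    using isCont_inverse_function[of 1 "inv \<tau> t" "inv \<tau>" \<tau>] by (simp add: iv cont sj)
  \<comment> \<open>The inverse of \<tau> is the phase as a function of time, and it solves the
    first-order equation p' = G p.\<close>
  have dinv: "(inv \<tau> has_real_derivative G (inv \<tau> t)) (at t)" for t
    using DERIV_inverse_function[OF \<tau>, of "inv \<tau>" t "t - 1" "t + 1"] Gpos[of "inv \<tau> t"]
    by (simp add: sj continv)
  \<comment> \<open>Periodicity of \<open>G\<close> makes the increment of \<tau> over a full turn
    constant; at 0 it is the integral defining the period.\<close>
  have shift: "\<tau> (x + 2 * pi) = \<tau> x + T" for x
  proof -
    have "((\<lambda>x. \<tau> (x + 2 * pi) - \<tau> x) has_real_derivative 0) (at x)" for x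
      using DERIV_shift[of \<tau> "1 / G (x + 2 * pi)" x "2 * pi"] \<tau>[of "x + 2 * pi"] \<tau>[of x]
      by (auto intro!: derivative_eq_intros simp: G_def phase_speed_periodic)
    then have "\<tau> (x + 2 * pi) - \<tau> x = \<tau> (0 + 2 * pi) - \<tau> 0"
      using DERIV_isconst_all[of "\<lambda>x. \<tau> (x + 2 * pi) - \<tau> x" x 0] by blast
    also have "\<dots> = T"
      unfolding T_def oscillation_period_def G_def[symmetric]
      using fundamental_theorem_of_calculus[of 0 "2 * pi" \<tau> "\<lambda>x. 1 / G x"] \<tau>
      by (simp add: has_real_derivative_iff_has_vector_derivative
          has_vector_derivative_at_within integral_unique)
    finally show ?thesis by simp
  qed
  define z where "z t = a * sin (inv \<tau> t)" for t
  have "vertical_motion m q z"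
    unfolding vertical_motion_def
  proof (intro exI allI conjI)
    fix t
    let ?p = "inv \<tau> t"
    show "(z has_real_derivative a * (cos (inv \<tau> t) * G (inv \<tau> t))) (at t)"
      unfolding z_def by (rule DERIV_cmult[OF DERIV_chain2[OF DERIV_sin dinv]])
    obtain d where d: "(G has_real_derivative d) (at ?p)"
      and eq: "a * (cos ?p * d - sin ?p * G ?p) * G ?p
       = - (\<Sum>i\<in>UNIV. m i * (a * sin ?p) / ((norm (q i))\<^sup>2 + (a * sin ?p)\<^sup>2) powr (3/2))"
      by (rule phase_speed_deriv[of m "\<lambda>i. norm (q i)" a ?p, OF assms, folded G_def])
    have "((\<lambda>t. a * (cos (inv \<tau> t) * G (inv \<tau> t))) has_real_derivative
        a * (cos ?p * d - sin ?p * G ?p) * G ?p) (at t)"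
      by (rule DERIV_cong[OF DERIV_cmult[OF DERIV_mult[OF DERIV_chain2[OF DERIV_cos dinv]
              DERIV_chain2[where g = "inv \<tau>", OF d dinv]]]])
        (simp add: algebra_simps)
    then show "((\<lambda>t. a * (cos (inv \<tau> t) * G (inv \<tau> t))) has_real_derivative
        - (\<Sum>i\<in>UNIV. m i * z t / ((norm (q i))\<^sup>2 + (z t)\<^sup>2) powr (3/2))) (at t)"
      unfolding eq z_def .
  qed
  moreover have "z (t + T) = z t" for t
  proof -
    have "inv \<tau> (t + T) = inv \<tau> t + 2 * pi"
      by (metis shift sj iv)
    then show ?thesis by (simp add: z_def)
  qed
  moreover have "z t \<le> a" for t
    using assms(3) mult_left_mono[OF sin_le_one, of a] by (simp add: z_def)
  moreover have "z (\<tau> (pi / 2)) = a"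
    by (simp add: z_def iv)
  ultimately show ?thesis unfolding T_def by blast
qed

text \<open>The intermediate value theorem is applied between amplitude 1 and a large amplitude
  \<open>b\<close>, so the limit of the period at small amplitudes need not be computed.\<close>

lemma exists_amplitude_with_period:
  fixes m r :: "'n::finite \<Rightarrow> real"
  assumes "\<And>i. m i > 0" "\<And>i. r i > 0" and "T \<ge> oscillation_period m r 1"
  shows "\<exists>a>0. oscillation_period m r a = T"
proof -
  define K where "K = sqrt (\<Sum>i\<in>UNIV. 2 * m i / r i)"
  have "0 < (\<Sum>i\<in>UNIV. 2 * m i / r i)"
    using assms(1,2) by (intro sum_pos) simp_all
  then have K: "K > 0" by (simp add: K_def)
  have cont: "continuous_on ({1..b} \<times> {0..2 * pi}) (\<lambda>x. 1 / phase_speed m r (fst x) (snd x))" for b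
    using phase_speed_bounds(1)[of m r, OF assms(1,2)]
    by (intro continuous_on_divide continuous_on_const continuous_on_phase_speed assms ballI)
      (force simp: less_le)
  have contT: "continuous_on {1..b} (oscillation_period m r)" for b
    using integral_continuous_on_param[of "{1..b}" 0 "2 * pi" "\<lambda>a p. 1 / phase_speed m r a p"]
      cont[of b]
    unfolding oscillation_period_def[abs_def] by (simp add: case_prod_unfold cbox_interval)
  have lower: "2 * pi * a / K \<le> oscillation_period m r a" if "a \<ge> 1" for a
  proof -
    have "continuous_on {0..2 * pi} (\<lambda>p. 1 / phase_speed m r a p)"
    proof -
      have "continuous_on {0..2 * pi} (\<lambda>p. (a, p))"
        by (intro continuous_intros)
      moreover have "(\<lambda>p. (a, p)) ` {0..2 * pi} \<subseteq> {1..a} \<times> {0..2 * pi}"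
        using that by auto
      ultimately have "continuous_on {0..2 * pi} (\<lambda>p. 1 / phase_speed m r (fst (a, p)) (snd (a, p)))"
        by (rule continuous_on_compose2[OF cont[of a]])
      then show ?thesis by (simp only: fst_conv snd_conv)
    qed
    then have "integral {0..2 * pi} (\<lambda>p. a / K) \<le> oscillation_period m r a"
      unfolding oscillation_period_def
      using phase_speed_bounds(2)[of m r a, OF assms(1,2)] that
      by (intro integral_le integrable_continuous_interval) (auto simp: K_def)
    then show ?thesis by (simp add: mult.assoc)
  qed
  \<comment> \<open>The second entry makes the lower bound 2 pi b / K at least |T|; the maximum with
    1 keeps \<open>b\<close> where that bound is available.\<close>
  define b where "b = max 1 (\<bar>T\<bar> * K / (2 * pi))"
  have "2 * pi * (\<bar>T\<bar> * K / (2 * pi)) / K \<le> 2 * pi * b / K"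
    using K by (intro divide_right_mono mult_left_mono) (auto simp: b_def)
  then have "T \<le> 2 * pi * b / K" using K by simp
  then have "T \<le> oscillation_period m r b"
    using lower[of b] by (simp add: b_def)
  then obtain a where "1 \<le> a" "oscillation_period m r a = T"
    using IVT'[of "oscillation_period m r" 1 T b] assms(3) contT by (auto simp: b_def)
  then show ?thesis by (intro exI[of _ a]) auto
qed

section \<open>Resonance with the rotation of the primaries\<close>

theorem corollary1:
  fixes m :: "'n::{finite,linorder} \<Rightarrow> real" and q :: "'n \<Rightarrow> real ^ 3" and l :: real
  assumes "CARD('n) \<ge> 2"
    and "planar_configuration m q"
    and "central_configuration l m q"
    and "balanced_configuration m q"
    and "collisionless q"
  shows "\<exists>S. infinite S \<and>
           (\<forall>x\<in>S. complete_system_solution l m q x \<and> periodic_motion x) \<and>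
           pairwise (\<lambda>x y. \<not> same_up_to_phase x y) S"
proof -
  have m: "m i > 0" and r: "norm (q i) > 0" for i
    using assms(2,5) by (auto simp: planar_configuration_def collisionless_def)
  obtain P where P: "P > 0"
    and rot: "rotation_z (sqrt l * (t + real k * P)) = rotation_z (sqrt l * t)" for t k
  \<comment> \<open>For \<open>l = 0\<close> the rotation is constant and any positive
    \<open>P\<close> serves. For negative \<open>l\<close>, \<open>sqrt l\<close> is the negative
    number - sqrt (- l): the rotation runs backwards, and the sign is absorbed into the integer
    number of turns.\<close>
  proof (cases "l = 0")
    case True
    then show ?thesis by (intro that[of 1]) auto
  next
    case False
    define P where "P = 2 * pi / \<bar>sqrt l\<bar>"
    have P: "P > 0" using False by (simp add: P_def)
    have angle: "sqrt l * (t + real k * P)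
        = sqrt l * t + 2 * pi * of_int (int k * (if l > 0 then 1 else -1))"
      for t k
      using False by (auto simp: P_def field_simps)
    have "rotation_z (x + 2 * pi * of_int j) = rotation_z x" for x j
      by (simp add: rotation_z_def sin_add cos_add)
    then show ?thesis using P by (intro that[of P]) (simp_all only: angle)
  qed
  define per where "per = oscillation_period m (\<lambda>i. norm (q i))"
  obtain N :: nat where "real N \<ge> per 1 / P"
    using real_arch_simple by blast
  then have N: "real N * P \<ge> per 1" using P by (simp add: field_simps)
  \<comment> \<open>The successor makes every multiple of \<open>P\<close> visibly positive, even if
    \<open>N\<close> and \<open>k\<close> are 0, as a period has to be.\<close>
  have "per 1 \<le> real (Suc (N + k)) * P" for k
  proof -
    have "real N * P \<le> real (Suc (N + k)) * P"
      using P by (intro mult_right_mono) auto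
    then show ?thesis using N by linarith
  qed
  then have "\<forall>k. \<exists>a>0. per a = real (Suc (N + k)) * P"
    unfolding per_def using exists_amplitude_with_period[of m "\<lambda>i. norm (q i)", OF m r] by blast
  then obtain a where a: "a k > 0" "per (a k) = real (Suc (N + k)) * P" for k
    by metis
  have "\<forall>k. \<exists>z. vertical_motion m q z \<and> (\<forall>t. z (t + per (a k)) = z t)
      \<and> (\<forall>t. z t \<le> a k) \<and> (\<exists>t. z t = a k)"
    unfolding per_def using exists_oscillation[of m q, OF m r a(1)] by blast
  then obtain z where z: "vertical_motion m q (z k)" "z k (t + per (a k)) = z k t"
      "z k t \<le> a k" "\<exists>t. z k t = a k" for k t
    by metis
  define x where "x k = (\<lambda>t. (vector [0, 0, z k t] :: real ^ 3,
      \<lambda>j. rotation_z (sqrt l * t) *v q j))" for k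
  \<comment> \<open>The maximum \<open>a k\<close> is attained by \<open>z k\<close>, hence is also
    a value of its shift \<open>z j\<close>, which is bounded by \<open>a j\<close>.\<close>
  have amplitude_le: "a k \<le> a j" if "\<And>t. z k t = z j (t + s)" for k j s
    by (metis that z(3,4))
  have same: "j = k" if jk: "same_up_to_phase (x j) (x k)" for j k
  proof -
    obtain s where s: "vector [0, 0, z k t] = (vector [0, 0, z j (t + s)] :: real ^ 3)" for t
      using jk unfolding same_up_to_phase_def x_def fst_conv by blast
    have kj: "z k t = z j (t + s)" for t
      using arg_cong[OF s[of t], of "\<lambda>v. v $ 3"] by simp
    have "z j t = z k (t + - s)" for t
      by (simp add: kj)
    \<comment> \<open>Shifting by \<open>s\<close> and by \<open>- s\<close> gives the two
      inequalities. Equal amplitudes have equal periods, and these determine the index.\<close>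
    then have "a k = a j"
      using amplitude_le kj by (intro antisym) blast+
    then show ?thesis using a(2)[of j] a(2)[of k] P by simp
  qed
  have refl: "same_up_to_phase y y" for y :: "real \<Rightarrow> (real ^ 3) \<times> ('n \<Rightarrow> real ^ 3)"
    unfolding same_up_to_phase_def by (rule exI[of _ 0]) simp
  \<comment> \<open>Equal motions agree up to the zero shift, so \<open>same\<close> also shows that
    the family has no repetitions.\<close>
  have "inj x"
    by (rule injI) (metis refl same)
  then have "infinite (range x)"
    by (simp add: finite_image_iff)
  moreover have "complete_system_solution l m q (x k)" for k
    unfolding complete_system_solution_def x_def using z(1) by blast
  moreover have "periodic_motion (x k)" for k
    unfolding periodic_motion_def x_def
  proof (intro exI[of _ "per (a k)"] conjI allI)
    show "per (a k) > 0" using P by (simp add: a(2) add_pos_nonneg)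
  \<comment> \<open>The vertical period is a whole multiple of \<open>P\<close>, so particle and
    primaries return together.\<close>
  qed (simp only: z(2), simp only: a(2) rot)
  moreover have "pairwise (\<lambda>x y. \<not> same_up_to_phase x y) (range x)"
    unfolding pairwise_def using same by blast
  ultimately show ?thesis by (intro exI[of _ "range x"]) blast
qed

end
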